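(* Let $\mathcal{G} = (\mathcal{V}_{\mathsf{x}}, \mathcal{E}_{\mathsf{x}})$ be an exchange graph and let $f_{\mathrm{e}} : 2^{\mathcal{E}_{\mathsf{x}}} \to \mathbb{R}_{\geq 0}$ be normalized, monotone and submodular (NMS). Define $f_{\mathrm{v}} : 2^{\mathcal{V}_{\mathsf{x}}} \to \mathbb{R}_{\geq 0}$ by $f_{\mathrm{v}}(\mathcal{V}) = f_{\mathrm{e}}\big(\mathrm{edges}(\mathcal{V})\big)$ for every $\mathcal{V} \subseteq \mathcal{V}_{\mathsf{x}}$. Then $f_{\mathrm{v}}$ is normalized, monotone and submodular.
   Context: An exchange graph is a finite simple undirected graph $\mathcal{G} = (\mathcal{V}_{\mathsf{x}}, \mathcal{E}_{\mathsf{x}})$ (endowed with vertex weights $w : \mathcal{V}_{\mathsf{x}} \to \mathbb{R}_{>0}$ and edge probabilities $p : \mathcal{E}_{\mathsf{x}} \to (0,1]$, which play no role in this statement). For $\mathcal{V} \subseteq \mathcal{V}_{\mathsf{x}}$, $\mathrm{edges}(\mathcal{V}) \subseteq \mathcal{E}_{\mathsf{x}}$ denotes the set of all edges in $\mathcal{E}_{\mathsf{x}}$ having at least one endpoint in $\mathcal{V}$. A set function $f : 2^{\mathcal{W}} \to \mathbb{R}_{\geq 0}$ on a finite set $\mathcal{W}$ is NMS if it is: normalized, $f(\varnothing) = 0$; monotone, $f(\mathcal{A}) \leq f(\mathcal{B})$ whenever $\mathcal{A} \subseteq \mathcal{B} \subseteq \mathcal{W}$; and submodular, $f(\mathcal{A})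 + f(\mathcal{B}) \geq f(\mathcal{A} \cup \mathcal{B}) + f(\mathcal{A} \cap \mathcal{B})$ for all $\mathcal{A}, \mathcal{B} \subseteq \mathcal{W}$. *)

theory Defs
  imports Complex_Main
begin

locale simple_graph =
  fixes V :: "'a set" and E :: "'a set set"
  assumes finite_verts: "finite V"
    and edge_in_verts: "e \<in> E \<Longrightarrow> e \<subseteq> V"
    and edge_card: "e \<in> E \<Longrightarrow> card e = 2"

locale exchange_graph = simple_graph V E
  for V :: "'a set" and E :: "'a set set" +
  fixes w :: "'a \<Rightarrow> real" and p :: "'a set \<Rightarrow> real"
  assumes weight_pos: "v \<in> V \<Longrightarrow> 0 < w v"
    and prob_range: "e \<in> E \<Longrightarrow> p e \<in> {0<..1}"

definition edges_of :: "'a set set \<Rightarrow> 'a set \<Rightarrow> 'a set set" where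
  "edges_of E X = {e \<in> E. \<exists>v\<in>e. v \<in> X}"

definition submodular_on :: "'b set \<Rightarrow> ('b set \<Rightarrow> real) \<Rightarrow> bool" where
  "submodular_on W f \<longleftrightarrow>
    (\<forall>A B. A \<subseteq> W \<longrightarrow> B \<subseteq> W \<longrightarrow> f A + f B \<ge> f (A \<union> B) + f (A \<inter> B))"

(* A set function on W is a total HOL function of which only the values on
   subsets of W matter; the first two conjuncts say that W is finite and that
   f maps Pow W into the nonnegative reals. *)
definition NMS :: "'b set \<Rightarrow> ('b set \<Rightarrow> real) \<Rightarrow> bool" where
  "NMS W f \<longleftrightarrow>
    finite W \<and> (\<forall>A. A \<subseteq> W \<longrightarrow> 0 \<le> f A) \<and>
    f {} = 0 \<and> mono_on (Pow W) f \<and> submodular_on W f"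

end

(* Taking incident edges commutes with unions, but an edge joining A to B need not meet
   A \<inter> B, so only edges(A \<inter> B) \<subseteq> edges(A) \<inter> edges(B) holds. Monotonicity of f_e
   bridges this gap in the submodular inequality. *)
theory Submission
  imports Defs
begin

lemma edges_of_subset: "edges_of E X \<subseteq> E"
  by (auto simp: edges_of_def)

lemma edges_of_empty: "edges_of E {} = {}"
  by (simp add: edges_of_def)

lemma edges_of_mono: "X \<subseteq> Y \<Longrightarrow> edges_of E X \<subseteq> edges_of E Y"
  by (auto simp: edges_of_def)

text \<open>The existential over endpoints distributes over the disjunction, so nothing is lost on
  the union term.\<close>

lemma edges_of_Un: "edges_of E (X \<union> Y) = edges_of E X \<union> edges_of E Y"
  by (auto simp: edges_of_def)

lemma edges_of_Int_subset: "edges_of E (X \<inter> Y) \<subseteq> edges_of E X \<inter> edges_of E Y"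
  by (auto simp: edges_of_def)

theorem theorem1:
  fixes V :: "'a set" and E :: "'a set set"
    and w :: "'a \<Rightarrow> real" and p :: "'a set \<Rightarrow> real"
    and f_e :: "'a set set \<Rightarrow> real" and f_v :: "'a set \<Rightarrow> real"
  assumes "exchange_graph V E w p"
    and "NMS E f_e"
    and "\<And>X. X \<subseteq> V \<Longrightarrow> f_v X = f_e (edges_of E X)"
  shows "NMS V f_v"
proof -
  \<comment> \<open>Supplies \<open>finite_verts\<close>, the finiteness of the ground set demanded
    by \<open>NMS V f_v\<close>.\<close>
  interpret exchange_graph V E w p by fact
  have nonneg: "0 \<le> f_e F" if "F \<subseteq> E" for F
    using assms(2) that by (simp add: NMS_def)
  have normalized: "f_e {} = 0"
    using assms(2) by (simp add: NMS_def)
  have mono: "f_e F \<le> f_e G" if "F \<subseteq> G" "G \<subseteq> E" for F G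
    using assms(2) that unfolding NMS_def by (blast intro: mono_onD)
  have submod: "f_e (F \<union> G) + f_e (F \<inter> G) \<le> f_e F + f_e G" if "F \<subseteq> E" "G \<subseteq> E" for F G
    using assms(2) that by (simp add: NMS_def submodular_on_def)
  have "f_v (A \<union> B) + f_v (A \<inter> B) \<le> f_v A + f_v B" if "A \<subseteq> V" "B \<subseteq> V" for A B
  proof -
    let ?A = "edges_of E A" and ?B = "edges_of E B"
    have "f_v (A \<union> B) = f_e (?A \<union> ?B)"
      using that by (simp add: assms(3) edges_of_Un)
    moreover have "f_v (A \<inter> B) \<le> f_e (?A \<inter> ?B)"
    proof -
      have "f_v (A \<inter> B) = f_e (edges_of E (A \<inter> B))"
        using that by (intro assms(3)) blast
      also have "\<dots> \<le> f_e (?A \<inter> ?B)"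
        \<comment> \<open>\<open>mono\<close> also asks that the larger set lie in \<open>E\<close>;
          \<open>le_infI1\<close> reduces this to \<open>?A \<subseteq> E\<close>.\<close>
        by (intro mono edges_of_Int_subset le_infI1 edges_of_subset)
      finally show ?thesis .
    qed
    moreover have "f_e (?A \<union> ?B) + f_e (?A \<inter> ?B) \<le> f_v A + f_v B"
      using submod[OF edges_of_subset edges_of_subset] that by (simp add: assms(3))
    ultimately show ?thesis by linarith
  qed
  moreover have "f_v A \<le> f_v B" if "A \<subseteq> B" "B \<subseteq> V" for A B
    \<comment> \<open>Monotonicity of \<open>f_e\<close> along nested incident edge sets;
      transitivity places \<open>A\<close> inside \<open>V\<close>, where \<open>f_v\<close> is
      given by \<open>f_e\<close>.\<close>
    using mono[OF edges_of_mono[OF that(1)] edges_of_subset] that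
    by (simp add: assms(3) subset_trans[OF that])
  ultimately show ?thesis
    \<comment> \<open>What remains is finiteness, nonnegativity (incident edges form a subset of
      \<open>E\<close>) and normalization (the empty set meets no edge).\<close>
    by (auto simp: NMS_def submodular_on_def finite_verts assms(3) nonneg normalized
        edges_of_subset edges_of_empty intro!: mono_onI)
qed

end
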